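(* Let $n\ge 3$, let $k$ be a field, let $R=k[x_1,\ldots,x_n]$, and let $I=(x_1x_2,\,x_2x_3,\,\ldots,\,x_{n-1}x_n,\,x_nx_1)$ (that is, $I$ is the edge ideal of a cycle graph of length $n$). Then $I$ is $\omega$-linear.
   Context: $\mathbb{N}=\{1,2,\ldots\}$. For $N\in\mathbb{N}$, an ideal $I$ of a commutative ring $R$ with unity is $N$-absorbing if whenever $f_1,\ldots,f_{N+1}\in R$ satisfy $f_1\cdots f_{N+1}\in I$, there is some $j$ such that the product of the $f_i$ with $i\ne j$ lies in $I$. $\omega(I)$ is the least $N\in\mathbb{N}$ for which $I$ is $N$-absorbing, or $\infty$ if there is none; by convention $\omega(R)=0$. An ideal $I$ is $\omega$-linear if $\omega(I^m)=m\,\omega(I)$ for each $m\in\mathbb{N}$. *)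

theory Defs
  imports "HOL-Library.Poly_Mapping" "HOL-Library.Extended_Nat" "HOL-Algebra.Ideal_Product"
begin

section \<open>Absorbing ideals\<close>

definition absorbing_ideal :: "nat \<Rightarrow> 'a set \<Rightarrow> ('a, 'b) ring_scheme \<Rightarrow> bool" where
  "absorbing_ideal N I R \<longleftrightarrow> ideal I R \<and>
     (\<forall>f \<in> {1..N + 1} \<rightarrow> carrier R.
        (\<Otimes>\<^bsub>R\<^esub>i\<in>{1..N + 1}. f i) \<in> I \<longrightarrow>
        (\<exists>j\<in>{1..N + 1}. (\<Otimes>\<^bsub>R\<^esub>i\<in>{1..N + 1} - {j}. f i) \<in> I))"

text \<open>The infimum of the empty set in \<^typ>\<open>enat\<close> is \<^term>\<open>\<infinity>::enat\<close>.\<close>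

definition omega :: "('a, 'b) ring_scheme \<Rightarrow> 'a set \<Rightarrow> enat" where
  "omega R I = (if I = carrier R then 0
                else Inf {enat N | N. 1 \<le> N \<and> absorbing_ideal N I R})"

text \<open>Powers of ideals are taken in the semiring \<^term>\<open>ideals_set R\<close> of ideals of \<open>R\<close>, whose
  multiplication is \<^const>\<open>ideal_prod\<close>.\<close>

definition omega_linear :: "('a, 'b) ring_scheme \<Rightarrow> 'a set \<Rightarrow> bool" where
  "omega_linear R I \<longleftrightarrow>
     (\<forall>m::nat. 1 \<le> m \<longrightarrow> omega R (I [^]\<^bsub>ideals_set R\<^esub> m) = enat m * omega R I)"


section \<open>Polynomials in the variables $x_1, \ldots, x_n$\<close>

text \<open>Exponent vectors are finitely supported maps \<^typ>\<open>nat \<Rightarrow>\<^sub>0 nat\<close>, and a polynomial is the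
  finitely supported map sending an exponent vector to its coefficient. Multiplication in this
  type is convolution, i.e. multiplication of polynomials in countably many variables. The ring
  in \<open>n\<close> variables is its subring of polynomials involving only variables with index in
  \<open>{1..n}\<close>.\<close>

type_synonym 'k mpoly = "(nat \<Rightarrow>\<^sub>0 nat) \<Rightarrow>\<^sub>0 'k"

definition X :: "nat \<Rightarrow> 'k::comm_ring_1 mpoly" where
  "X i = Poly_Mapping.single (Poly_Mapping.single i 1) 1"

definition mpoly_ring :: "nat \<Rightarrow> 'k::comm_ring_1 mpoly ring" where
  "mpoly_ring n = \<lparr> carrier = {p. \<forall>e \<in> Poly_Mapping.keys p. Poly_Mapping.keys e \<subseteq> {1..n}},
                    mult = (*), one = 1, zero = 0, add = (+) \<rparr>"

definition cycle_edge_ideal :: "nat \<Rightarrow> 'k::comm_ring_1 mpoly set" where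
  "cycle_edge_ideal n =
     Idl\<^bsub>mpoly_ring n\<^esub> (insert (X n * X 1) {X i * X (i + 1) | i. 1 \<le> i \<and> i < n})"

lemma mpoly_ring_simps [simp]:
  "p \<otimes>\<^bsub>mpoly_ring n\<^esub> q = p * q"
  "p \<oplus>\<^bsub>mpoly_ring n\<^esub> q = p + q"
  "\<one>\<^bsub>mpoly_ring n\<^esub> = 1"
  "\<zero>\<^bsub>mpoly_ring n\<^esub> = 0"
  by (simp_all add: mpoly_ring_def)

lemma mpoly_ring_carrier_iff:
  "p \<in> carrier (mpoly_ring n) \<longleftrightarrow>
     (\<forall>e \<in> Poly_Mapping.keys p. Poly_Mapping.keys e \<subseteq> {1..n})"
  by (simp add: mpoly_ring_def)

lemma X_in_mpoly_ring: "i \<in> {1..n} \<Longrightarrow> X i \<in> carrier (mpoly_ring n)"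
  by (simp add: X_def mpoly_ring_carrier_iff)

lemma mpoly_ring_cring: "cring (mpoly_ring n :: 'k::comm_ring_1 mpoly ring)"
proof (rule cringI)
  let ?R = "mpoly_ring n :: 'k mpoly ring"
  have add: "p + q \<in> carrier ?R" if "p \<in> carrier ?R" "q \<in> carrier ?R" for p q
    using that Poly_Mapping.keys_add[of p q] unfolding mpoly_ring_carrier_iff by blast
  have mult: "p * q \<in> carrier ?R" if "p \<in> carrier ?R" "q \<in> carrier ?R" for p q
    unfolding mpoly_ring_carrier_iff
  proof
    fix e assume "e \<in> Poly_Mapping.keys (p * q)"
    then obtain a b where ab: "e = a + b" "a \<in> Poly_Mapping.keys p" "b \<in> Poly_Mapping.keys q"
      using Poly_Mapping.keys_mult[of p q] by blast
    then have "Poly_Mapping.keys a \<subseteq> {1..n}" "Poly_Mapping.keys b \<subseteq> {1..n}"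
      using that unfolding mpoly_ring_carrier_iff by blast+
    then show "Poly_Mapping.keys e \<subseteq> {1..n}"
      using Poly_Mapping.keys_add[of a b] ab(1) by blast
  qed
  have zero: "0 \<in> carrier ?R" and one: "1 \<in> carrier ?R"
    by (simp_all add: mpoly_ring_carrier_iff)
  have uminus: "- p \<in> carrier ?R" if "p \<in> carrier ?R" for p
    using that by (simp add: mpoly_ring_carrier_iff in_keys_iff)
  show "abelian_group ?R"
  proof (rule abelian_groupI, unfold mpoly_ring_simps)
    fix p assume "p \<in> carrier ?R"
    then show "\<exists>q\<in>carrier ?R. q + p = 0"
      using uminus by (intro bexI[of _ "- p"]) simp_all
  qed (use add zero in \<open>simp_all add: ac_simps\<close>)
  show "comm_monoid ?R"
    by (rule comm_monoidI, unfold mpoly_ring_simps) (use mult one in \<open>simp_all add: ac_simps\<close>)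
qed (simp add: distrib_right)

end

theory Submission
  imports Defs
begin

text \<open>Let $t$ be the number of minimal vertex covers of the cycle. The theorem follows from
$\omega(I^m) = m t$ for all $m \ge 1$, which rests on an explicit description of $I^m$. For a set
$C$ of variables let $\mathrm{ord}_C(f)$ be the least total degree in the variables of $C$ that
occurs among the monomials of $f$; over a field this is additive on products. Then
\<open>mem_cycle_edge_ideal_power_iff\<close> says that $f \in I^m$ if and only if $\mathrm{ord}_C(f) \ge m$ for each
minimal vertex cover $C$ and the order of $f$ along all the variables is at least $2m$. In ideal
terms, $I^m$ is the intersection of the powers $P_C^m$ of the minimal primes of $I$ with
$\mathfrak{m}^{2m}$, where $\mathfrak{m} = (x_1, \ldots, x_n)$.

Since all these ideals are monomial, the description reduces to a statement on exponent vectors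
$a$: there are $m$ edges, repetitions allowed, that use each vertex $v$ at most $a_v$ times, as
soon as $a(C) \ge m$ for each vertex cover $C$ and $a$ has total weight at least $2m$
(\<open>cycle_packing\<close>). For a path the cover condition alone is enough, by a greedy argument
(\<open>path_packing\<close>). For the cycle, one first decides how often the edge $\{n, 1\}$ is used, and is
left with a path. A good choice exists unless some cover $C$ of the path that avoids both ends and
some cover $D$ that contains both ends have $a(C) + a(D) < 2m$. If $C$ and $D$ can exchange their
tails somewhere, they become two covers of the cycle, so $a(C) + a(D) \ge 2m$; otherwise they are
complementary, and $a(C) + a(D)$ is the total weight (\<open>path_cover_exchange\<close>).

Upper bound: if a product of elements lies in $I^m$, at most $m$ factors suffice to reach order
$m$ along any one $C$. All of the at most $m t$ factors selected in this way have positive order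
along $\{1, \ldots, n\}$. If they are fewer than $2m$, further factors of positive order are added
until there are $2m$ of them or the order $2m$ is reached; as $t \ge 2$, there are still at most
$m t$.

Lower bound: the polynomial $g_C = \sum_{v \in C} x_v$ has
order 1 along $C$ and order 0 along each other minimal cover. The product in which each $g_C$
occurs $m$ times lies in $I^m$, and it leaves $I^m$ as soon as one of its $m t$ factors is dropped.\<close>

section \<open>Vertex covers and edge packings of paths and cycles\<close>

definition path_cover :: "nat \<Rightarrow> nat set \<Rightarrow> bool" where
  "path_cover n C \<longleftrightarrow> C \<subseteq> {1..n} \<and> (\<forall>i. 1 \<le> i \<and> i < n \<longrightarrow> i \<in> C \<or> i + 1 \<in> C)"

definition cycle_cover :: "nat \<Rightarrow> nat set \<Rightarrow> bool" where
  "cycle_cover n C \<longleftrightarrow> path_cover n C \<and> (n \<in> C \<or> 1 \<in> C)"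

text \<open>A greedy argument from the end of the path. Of the last two vertices, let the lighter one be
saturated by the edge between them: this edge loses nothing against any other choice. What remains
is a shorter path, and each of its covers extends to a cover of the whole path by the saturated
vertex at most. The number $y_i$ counts how often the edge $\{i, i+1\}$ is used; the values
$y_0 = y_n = 0$ belong to edges that do not exist and make the constraint uniform in all vertices.\<close>

lemma path_packing:
  fixes b :: "nat \<Rightarrow> nat"
  assumes "\<And>C. path_cover n C \<Longrightarrow> m \<le> sum b C"
  shows "\<exists>y. y 0 = 0 \<and> y n = 0 \<and> (\<forall>i\<in>{1..n}. y (i - 1) + y i \<le> b i) \<and> m \<le> sum y {1..n}"
  using assms
proof (induction n arbitrary: b m rule: less_induct)
  case (less n)
  show ?case
  proof (cases "n < 2")
    case True
    have "path_cover n {}"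
      using True by (auto simp: path_cover_def)
    with less.prems have "m = 0"
      by fastforce
    then show ?thesis
      by (intro exI[of _ "\<lambda>_. 0"]) auto
  next
    case False
    define k where "k = n - 2"
    have n: "n = Suc (Suc k)"
      using False by (simp add: k_def)
    show ?thesis
    proof (cases "b (Suc k) \<le> b n")
      case True
      have "m - b (Suc k) \<le> sum b C" if "path_cover k C" for C
      proof -
        have C: "C \<subseteq> {1..k}"
          using that by (simp add: path_cover_def)
        then have fin: "finite C" and nin: "Suc k \<notin> C"
          using finite_subset by auto
        have "path_cover n (insert (Suc k) C)"
          using that unfolding path_cover_def n by (auto simp: less_Suc_eq)
        from less.prems[OF this] show ?thesis
          using fin nin by simp
      qed
      moreover have "k < n" by (simp add: n)
      ultimately obtain y where y: "y 0 = 0" "y k = 0"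
          "\<forall>i\<in>{1..k}. y (i - 1) + y i \<le> b i" "m - b (Suc k) \<le> sum y {1..k}"
        using less.IH[of k "m - b (Suc k)" b] by blast
      define y' where "y' = y (Suc k := b (Suc k), n := 0)"
      have "sum y' {1..k} = sum y {1..k}"
        by (rule sum.cong) (auto simp: y'_def n)
      then have "sum y' {1..n} = sum y {1..k} + b (Suc k)"
        by (simp add: n y'_def)
      moreover have "y' (i - 1) + y' i \<le> b i" if "i \<in> {1..n}" for i
      proof -
        have "i \<in> {1..k} \<or> i = Suc k \<or> i = n"
          using that by (auto simp: n)
        then consider "i \<in> {1..k}" | "i = Suc k" | "i = n"
          by blast
        then show ?thesis
          using y True by cases (auto simp: y'_def n)
      qed
      ultimately show ?thesis
        using y by (intro exI[of _ y']) (auto simp: y'_def n)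
    next
      case False
      \<comment> \<open>The last vertex is lighter: all of its weight goes into the last edge, and only that vertex
        is removed from the path.\<close>
      define b' where "b' = b (Suc k := b (Suc k) - b n)"
      have "m - b n \<le> sum b' C" if "path_cover (Suc k) C" for C
      proof -
        have C: "C \<subseteq> {1..Suc k}"
          using that by (simp add: path_cover_def)
        then have fin: "finite C" and nin: "n \<notin> C"
          using finite_subset by (auto simp: n)
        show ?thesis
        proof (cases "Suc k \<in> C")
          case True
          have "path_cover n C"
            using that True unfolding path_cover_def n by (auto simp: less_Suc_eq)
          then have "m \<le> sum b C"
            by (rule less.prems)
          moreover have "sum b C = b (Suc k) + sum b (C - {Suc k})"
            using fin True by (rule sum.remove)
          moreover have "sum b' C = b' (Suc k) + sum b' (C - {Suc k})"
            using fin True by (rule sum.remove)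
          moreover have "sum b' (C - {Suc k}) = sum b (C - {Suc k})"
            by (rule sum.cong) (auto simp: b'_def)
          ultimately show ?thesis
            using False by (simp add: b'_def)
        next
          case False
          have "path_cover n (insert n C)"
            using that unfolding path_cover_def n by (auto simp: less_Suc_eq)
          then have "m \<le> sum b (insert n C)"
            by (rule less.prems)
          moreover have "sum b' C = sum b C"
            using False by (intro sum.cong) (auto simp: b'_def)
          ultimately show ?thesis
            using fin nin by simp
        qed
      qed
      moreover have "Suc k < n" by (simp add: n)
      ultimately obtain y where y: "y 0 = 0" "y (Suc k) = 0"
          "\<forall>i\<in>{1..Suc k}. y (i - 1) + y i \<le> b' i" "m - b n \<le> sum y {1..Suc k}"
        using less.IH[of "Suc k" "m - b n" b'] by blast
      define y' where "y' = y (Suc k := b n, n := 0)"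
      have "sum y' {1..k} = sum y {1..k}"
        by (rule sum.cong) (auto simp: y'_def n)
      then have "sum y' {1..n} = sum y {1..Suc k} + b n"
        using y(2) by (simp add: n y'_def)
      moreover have "y' (i - 1) + y' i \<le> b i" if "i \<in> {1..n}" for i
      proof -
        have "i \<in> {1..k} \<or> i = Suc k \<or> i = n"
          using that by (auto simp: n)
        then consider "i \<in> {1..k}" | "i = Suc k" | "i = n"
          by blast
        then show ?thesis
        proof cases
          case 1
          then have "y (i - 1) + y i \<le> b' i" using y(3) by auto
          then show ?thesis using 1 by (auto simp: y'_def b'_def n)
        next
          case 2
          have "y (Suc k - 1) + y (Suc k) \<le> b' (Suc k)" using y(3) by (rule bspec) simp
          then show ?thesis using 2 False y(2) by (auto simp: y'_def b'_def n)
        next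
          case 3
          then show ?thesis by (auto simp: y'_def n)
        qed
      qed
      ultimately show ?thesis
        using y by (intro exI[of _ y']) (auto simp: y'_def n)
    qed
  qed
qed

text \<open>If $C$ and $D$ can be cut between $i$ and $i + 1$ and joined crosswise without uncovering the edge
$\{i, i+1\}$, both results contain exactly one end of the path and so cover the closing edge
$\{n, 1\}$ too. If this fails at each $i$, then $C$ and $D$ are forced to alternate along the path
and partition its vertices.\<close>

lemma path_cover_exchange:
  fixes a :: "nat \<Rightarrow> nat"
  assumes cov: "\<And>C. cycle_cover n C \<Longrightarrow> m \<le> sum a C" and total: "2 * m \<le> sum a {1..n}"
    and C: "path_cover n C" "1 \<notin> C" "n \<notin> C"
    and D: "path_cover n D" "1 \<in> D" "n \<in> D"
  shows "2 * m \<le> sum a C + sum a D"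
proof -
  have sub: "C \<subseteq> {1..n}" "D \<subseteq> {1..n}"
    using C D by (auto simp: path_cover_def)
  then have fin: "finite C" "finite D"
    using finite_subset by blast+
  show ?thesis
  proof (cases "\<exists>i\<in>{1..<n}. (i \<in> C \<or> i + 1 \<in> D) \<and> (i \<in> D \<or> i + 1 \<in> C)")
    case True
    then obtain i where i: "i \<in> {1..<n}" "i \<in> C \<or> i + 1 \<in> D" "i \<in> D \<or> i + 1 \<in> C"
      by blast
    \<comment> \<open>The two covers that result from exchanging the tails beyond \<open>i\<close>.\<close>
    define E where "E = (C \<inter> {..i}) \<union> (D \<inter> {i<..})"
    define F where "F = (D \<inter> {..i}) \<union> (C \<inter> {i<..})"
    have "j \<in> E \<or> j + 1 \<in> E" "j \<in> F \<or> j + 1 \<in> F" if "1 \<le> j" "j < n" for j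
    proof -
      have "j \<in> C \<or> j + 1 \<in> C" "j \<in> D \<or> j + 1 \<in> D"
        using that C D unfolding path_cover_def by blast+
      then show "j \<in> E \<or> j + 1 \<in> E" "j \<in> F \<or> j + 1 \<in> F"
        using i by (cases j i rule: linorder_cases; auto simp: E_def F_def)+
    qed
    then have "cycle_cover n E" "cycle_cover n F"
      using sub C D i unfolding cycle_cover_def path_cover_def by (auto simp: E_def F_def)
    then have "m \<le> sum a E" "m \<le> sum a F"
      by (auto intro: cov)
    moreover have "sum a E = sum a (C \<inter> {..i}) + sum a (D \<inter> {i<..})"
      unfolding E_def using fin by (intro sum.union_disjoint) auto
    moreover have "sum a F = sum a (D \<inter> {..i}) + sum a (C \<inter> {i<..})"
      unfolding F_def using fin by (intro sum.union_disjoint) auto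
    moreover have split: "sum a B = sum a (B \<inter> {..i}) + sum a (B \<inter> {i<..})" if "finite B" for B
      using that by (subst sum.union_disjoint [symmetric]) (auto intro!: sum.cong)
    ultimately show ?thesis
      using split[OF fin(1)] split[OF fin(2)] by linarith
  next
    case False
    have alt: "(i \<in> C) \<noteq> (i \<in> D)" if "1 \<le> i" "i \<le> n" for i
      using that
    proof (induction i rule: nat_induct_at_least)
      case base
      then show ?case using C D by simp
    next
      case (Suc i)
      then have "(i \<in> C) \<noteq> (i \<in> D)" "\<not> ((i \<in> C \<or> i + 1 \<in> D) \<and> (i \<in> D \<or> i + 1 \<in> C))"
        using False by auto
      moreover have "i \<in> C \<or> i + 1 \<in> C" "i \<in> D \<or> i + 1 \<in> D"
        using Suc C D unfolding path_cover_def by auto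
      ultimately show ?case by auto
    qed
    then have "C \<inter> D = {}" "C \<union> D = {1..n}"
      using sub by fastforce+
    then show ?thesis
      using total fin sum.union_disjoint[of C D a] by simp
  qed
qed

text \<open>The closing edge $\{n, 1\}$ is used $z$ times, and the rest is a packing of the path for the
weights that remain. A path cover that avoids both ends gains nothing from these $z$ uses, so it
forces a lower bound on $z$; one that contains both ends loses $2z$, so it imposes an upper bound;
one with exactly one end imposes nothing, being a cover of the cycle. The least $z$ that satisfies
the lower bounds also satisfies the upper ones, by \<open>path_cover_exchange\<close>. As in \<open>path_packing\<close>,
$y_i$ belongs to the edge $\{i, i+1\}$, and $y_0 = y_n$ to the edge $\{n, 1\}$.\<close>

lemma cycle_packing:
  fixes a :: "nat \<Rightarrow> nat"
  assumes n: "n \<ge> 2"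
    and cov: "\<And>C. cycle_cover n C \<Longrightarrow> m \<le> sum a C" and total: "2 * m \<le> sum a {1..n}"
  shows "\<exists>y. y 0 = y n \<and> (\<forall>i\<in>{1..n}. y (i - 1) + y i \<le> a i) \<and> m \<le> sum y {1..n}"
proof -
  define P where "P z \<longleftrightarrow> (\<forall>C. path_cover n C \<and> 1 \<notin> C \<and> n \<notin> C \<longrightarrow> m \<le> sum a C + z)" for z
  define z where "z = (LEAST z. P z)"
  have "P m" by (simp add: P_def)
  then have Pz: "P z" unfolding z_def by (rule LeastI)
  have fin: "finite C" if "path_cover n C" for C
    using that finite_subset unfolding path_cover_def by blast
  \<comment> \<open>By minimality, a positive \<open>z\<close> is attained as the deficit of some cover that avoids both ends.\<close>
  have z: "z = 0 \<or> (\<exists>C. path_cover n C \<and> 1 \<notin> C \<and> n \<notin> C \<and> m = sum a C + z)"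
  proof (cases z)
    case (Suc w)
    then have "\<not> P w"
      unfolding z_def using not_less_Least by (metis lessI)
    then obtain C where "path_cover n C" "1 \<notin> C" "n \<notin> C" "\<not> m \<le> sum a C + w"
      unfolding P_def by blast
    moreover from this have "m \<le> sum a C + z"
      using Pz unfolding P_def by blast
    ultimately show ?thesis using Suc by fastforce
  qed simp
  \<comment> \<open>Adding either end to that cover makes it a cover of the cycle, so each end can pay for the
    deficit.\<close>
  have z1: "z \<le> a 1" and zn: "z \<le> a n"
  proof -
    have "z \<le> a v" if v: "v = 1 \<or> v = n" for v
      using z
    proof
      assume "\<exists>C. path_cover n C \<and> 1 \<notin> C \<and> n \<notin> C \<and> m = sum a C + z"
      then obtain C where C: "path_cover n C" "1 \<notin> C" "n \<notin> C" "m = sum a C + z"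
        by blast
      then have "cycle_cover n (insert v C)"
        using n v unfolding cycle_cover_def path_cover_def by auto
      then have "m \<le> sum a (insert v C)" by (rule cov)
      moreover have "sum a (insert v C) = a v + sum a C"
        using C v fin by (intro sum.insert) auto
      ultimately show ?thesis using C by simp
    qed simp
    then show "z \<le> a 1" "z \<le> a n" by auto
  qed
  have both: "m + z \<le> sum a D" if D: "path_cover n D" "1 \<in> D" "n \<in> D" for D
    using z
  proof
    assume "z = 0"
    then show ?thesis using cov[of D] D by (simp add: cycle_cover_def)
  next
    assume "\<exists>C. path_cover n C \<and> 1 \<notin> C \<and> n \<notin> C \<and> m = sum a C + z"
    then obtain C where "path_cover n C" "1 \<notin> C" "n \<notin> C" "m = sum a C + z"
      by blast
    with path_cover_exchange[OF cov total _ _ _ D, of C] show ?thesis by simp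
  qed
  define b where "b = a (1 := a 1 - z, n := a n - z)"
  have "m - z \<le> sum b C" if C: "path_cover n C" for C
  proof -
    have "sum a C = sum (\<lambda>i. b i + (if i = 1 then z else 0) + (if i = n then z else 0)) C"
      using z1 zn n by (intro sum.cong) (auto simp: b_def)
    also have "\<dots> = sum b C + (if 1 \<in> C then z else 0) + (if n \<in> C then z else 0)"
      using fin[OF C] by (simp add: sum.distrib)
    finally have eq: "sum a C = sum b C + (if 1 \<in> C then z else 0) + (if n \<in> C then z else 0)" .
    consider "1 \<in> C" "n \<in> C" | "1 \<notin> C" "n \<notin> C" | "cycle_cover n C" "\<not> (1 \<in> C \<and> n \<in> C)"
      using C by (auto simp: cycle_cover_def)
    then show ?thesis
    proof cases
      case 1
      then show ?thesis using both[OF C] eq by simp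
    next
      case 2
      then show ?thesis using Pz C eq by (auto simp: P_def)
    next
      case 3
      then show ?thesis using cov[of C] eq by (auto split: if_splits)
    qed
  qed
  from path_packing[OF this] obtain y where y: "y 0 = 0" "y n = 0"
      "\<forall>i\<in>{1..n}. y (i - 1) + y i \<le> b i" "m - z \<le> sum y {1..n}"
    by blast
  define y' where "y' = y (0 := z, n := z)"
  have "sum y' {1..n} = sum (\<lambda>i. y i + (if i = n then z else 0)) {1..n}"
    using y(2) by (intro sum.cong) (auto simp: y'_def)
  also have "\<dots> = sum y {1..n} + z"
    using n by (simp add: sum.distrib)
  finally have "m \<le> sum y' {1..n}"
    using y(4) by simp
  moreover have "y' (i - 1) + y' i \<le> a i" if i: "i \<in> {1..n}" for i
  proof -
    have "y (i - 1) + y i \<le> b i" using y i by blast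
    then show ?thesis
      using i n y(1,2) z1 zn by (auto simp: y'_def b_def split: if_splits)
  qed
  ultimately show ?thesis
    by (intro exI[of _ y']) (auto simp: y'_def)
qed

definition minimal_covers :: "nat \<Rightarrow> nat set set" where
  "minimal_covers n = {C. cycle_cover n C \<and> (\<forall>D. cycle_cover n D \<and> D \<subseteq> C \<longrightarrow> D = C)}"

lemma cycle_cover_subset: "cycle_cover n C \<Longrightarrow> C \<subseteq> {1..n}"
  by (simp add: cycle_cover_def path_cover_def)

lemma finite_cycle_covers: "finite {C. cycle_cover n C}"
  by (rule finite_subset[of _ "Pow {1..n}"]) (use cycle_cover_subset in \<open>blast, simp\<close>)

lemma finite_minimal_covers: "finite (minimal_covers n)"
  by (rule finite_subset[OF _ finite_cycle_covers]) (auto simp: minimal_covers_def)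

lemma minimal_cover_nonempty: "C \<in> minimal_covers n \<Longrightarrow> C \<noteq> {}"
  by (auto simp: minimal_covers_def cycle_cover_def)

lemma minimal_cover_subset: "C \<in> minimal_covers n \<Longrightarrow> C \<subseteq> {1..n}"
  unfolding minimal_covers_def using cycle_cover_subset by blast

lemma minimal_cover_finite: "C \<in> minimal_covers n \<Longrightarrow> finite C"
  by (rule finite_subset[OF minimal_cover_subset]) auto

lemma minimal_covers_antichain:
  "C \<in> minimal_covers n \<Longrightarrow> D \<in> minimal_covers n \<Longrightarrow> C \<subseteq> D \<Longrightarrow> C = D"
  by (auto simp: minimal_covers_def)

lemma cover_contains_minimal_cover:
  assumes "cycle_cover n C"
  obtains D where "D \<in> minimal_covers n" "D \<subseteq> C"
  using finite_has_minimal2[OF finite_cycle_covers, of C n] assms that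
  unfolding minimal_covers_def by auto

text \<open>No vertex lies in all minimal covers, because all vertices but one already form a cover.\<close>

lemma two_le_card_minimal_covers:
  assumes "n \<ge> 2"
  shows "2 \<le> card (minimal_covers n)"
proof -
  have "cycle_cover n {1..n}"
    using assms by (auto simp: cycle_cover_def path_cover_def)
  then obtain C where C: "C \<in> minimal_covers n"
    by (rule cover_contains_minimal_cover)
  then obtain v where v: "v \<in> C"
    using minimal_cover_nonempty by blast
  have "cycle_cover n ({1..n} - {v})"
    using assms by (auto simp: cycle_cover_def path_cover_def)
  then obtain D where D: "D \<in> minimal_covers n" "D \<subseteq> {1..n} - {v}"
    by (rule cover_contains_minimal_cover)
  with v have "C \<noteq> D"
    by blast
  then have "2 = card {C, D}"
    by simp
  also have "\<dots> \<le> card (minimal_covers n)"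
    using C D finite_minimal_covers by (intro card_mono) auto
  finally show ?thesis .
qed

section \<open>The order of a polynomial along a set of variables\<close>

definition weight :: "nat set \<Rightarrow> (nat \<Rightarrow>\<^sub>0 nat) \<Rightarrow> nat" where
  "weight C e = (\<Sum>i\<in>C. Poly_Mapping.lookup e i)"

text \<open>The zero polynomial has infinite order, since the infimum of the empty set is \<^term>\<open>\<infinity>::enat\<close>.\<close>

definition ord_along :: "nat set \<Rightarrow> 'k::zero mpoly \<Rightarrow> enat" where
  "ord_along C f = (INF e\<in>Poly_Mapping.keys f. enat (weight C e))"

lemma weight_add: "weight C (d + e) = weight C d + weight C e"
  by (simp add: weight_def lookup_add sum.distrib)

lemma weight_mono: "finite D \<Longrightarrow> C \<subseteq> D \<Longrightarrow> weight C e \<le> weight D e"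
  unfolding weight_def by (rule sum_mono2) auto

lemma le_ord_along_iff: "enat m \<le> ord_along C f \<longleftrightarrow> (\<forall>e\<in>Poly_Mapping.keys f. m \<le> weight C e)"
  by (simp add: ord_along_def le_INF_iff)

lemma ord_along_le: "e \<in> Poly_Mapping.keys f \<Longrightarrow> ord_along C f \<le> enat (weight C e)"
  unfolding ord_along_def by (rule INF_lower)

lemma ord_along_zero [simp]: "ord_along C 0 = \<infinity>"
  by (simp add: ord_along_def top_enat_def)

lemma ord_along_one [simp]: "ord_along C (1 :: 'k::zero_neq_one mpoly) = 0"
  by (simp add: ord_along_def weight_def zero_enat_def)

lemma ord_along_mono: "finite D \<Longrightarrow> C \<subseteq> D \<Longrightarrow> ord_along C f \<le> ord_along D f"
  unfolding ord_along_def by (intro INF_mono) (auto intro: weight_mono)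

lemma ord_along_attained:
  assumes "f \<noteq> 0"
  obtains e where "e \<in> Poly_Mapping.keys f" "ord_along C f = enat (weight C e)"
proof -
  have "Poly_Mapping.keys f \<noteq> {}"
    using assms by (metis lookup_not_eq_zero_eq_in_keys poly_mapping_eqI lookup_zero empty_iff)
  moreover have "Inf A \<in> A" if "A \<noteq> {}" for A :: "enat set"
    using that by (auto simp: Inf_enat_def intro: LeastI)
  ultimately have "(INF e\<in>Poly_Mapping.keys f. enat (weight C e))
      \<in> (\<lambda>e. enat (weight C e)) ` Poly_Mapping.keys f"
    by (metis image_is_empty)
  then show ?thesis
    using that unfolding ord_along_def by blast
qed

lemma lookup_sum_single:
  assumes "finite A"
  shows "Poly_Mapping.lookup (\<Sum>e\<in>A. Poly_Mapping.single e (c e)) x = (if x \<in> A then c x else 0)"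
  using assms by (simp add: lookup_sum lookup_single when_def)

lemma poly_mapping_sum_single:
  "f = (\<Sum>e\<in>Poly_Mapping.keys f. Poly_Mapping.single e (Poly_Mapping.lookup f e))"
  by (rule poly_mapping_eqI) (simp add: lookup_sum_single in_keys_iff)

text \<open>Separates the initial form of a nonzero polynomial, which consists of its terms of least weight.\<close>

lemma ord_along_split:
  fixes f :: "'k::comm_ring_1 mpoly"
  assumes "f \<noteq> 0"
  obtains p g h where "ord_along C f = enat p" "f = g + h" "g \<noteq> 0"
    "\<And>e. e \<in> Poly_Mapping.keys g \<Longrightarrow> weight C e = p"
    "\<And>e. e \<in> Poly_Mapping.keys h \<Longrightarrow> p < weight C e"
proof -
  obtain d where d: "d \<in> Poly_Mapping.keys f" "ord_along C f = enat (weight C d)"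
    using assms by (rule ord_along_attained)
  define g where "g = (\<Sum>e\<in>{e \<in> Poly_Mapping.keys f. weight C e = weight C d}.
    Poly_Mapping.single e (Poly_Mapping.lookup f e))"
  have g: "Poly_Mapping.lookup g x =
      (if x \<in> Poly_Mapping.keys f \<and> weight C x = weight C d then Poly_Mapping.lookup f x else 0)"
    for x
    unfolding g_def by (subst lookup_sum_single) auto
  show thesis
  proof
    show "ord_along C f = enat (weight C d)" by fact
    show "f = g + (f - g)" by simp
    have "Poly_Mapping.lookup g d \<noteq> 0" using d(1) by (simp add: g in_keys_iff)
    then show "g \<noteq> 0" by auto
    show "weight C e = weight C d" if "e \<in> Poly_Mapping.keys g" for e
      using that by (auto simp: in_keys_iff g split: if_splits)
    show "weight C d < weight C e" if "e \<in> Poly_Mapping.keys (f - g)" for e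
    proof -
      have "e \<in> Poly_Mapping.keys f" "weight C e \<noteq> weight C d"
        using that by (auto simp: in_keys_iff g lookup_minus split: if_splits)
      then show ?thesis
        using ord_along_le[of e f C] d by simp
    qed
  qed
qed

text \<open>The product of the initial forms of both factors is nonzero, as there are no zero divisors, and
all other contributions to the product have larger weight, so nothing cancels it.\<close>

lemma ord_along_mult:
  fixes f g :: "'k::field mpoly"
  shows "ord_along C (f * g) = ord_along C f + ord_along C g"
proof (cases "f = 0 \<or> g = 0")
  case False
  then have nz: "f \<noteq> 0" "g \<noteq> 0" by auto
  obtain p f0 f1 where f: "ord_along C f = enat p" "f = f0 + f1" "f0 \<noteq> 0"
    "\<And>e. e \<in> Poly_Mapping.keys f0 \<Longrightarrow> weight C e = p"
    "\<And>e. e \<in> Poly_Mapping.keys f1 \<Longrightarrow> p < weight C e"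
    using ord_along_split[OF nz(1)] by metis
  obtain q g0 g1 where g: "ord_along C g = enat q" "g = g0 + g1" "g0 \<noteq> 0"
    "\<And>e. e \<in> Poly_Mapping.keys g0 \<Longrightarrow> weight C e = q"
    "\<And>e. e \<in> Poly_Mapping.keys g1 \<Longrightarrow> q < weight C e"
    using ord_along_split[OF nz(2)] by metis
  have "f0 * g0 \<noteq> 0"
    using f g by simp
  then obtain e where e: "e \<in> Poly_Mapping.keys (f0 * g0)"
    by (metis lookup_not_eq_zero_eq_in_keys poly_mapping_eqI lookup_zero)
  then have we: "weight C e = p + q"
    using keys_mult[of f0 g0] f(4) g(4) by (fastforce simp: weight_add)
  have "e \<notin> Poly_Mapping.keys (f0 * g1)" "e \<notin> Poly_Mapping.keys (f1 * g)"
  proof -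
    show "e \<notin> Poly_Mapping.keys (f0 * g1)"
      using keys_mult[of f0 g1] f(4) g(5) we by (fastforce simp: weight_add)
    have "q \<le> weight C d" if "d \<in> Poly_Mapping.keys g" for d
      using that ord_along_le[of d g C] g(1) by simp
    then show "e \<notin> Poly_Mapping.keys (f1 * g)"
      using keys_mult[of f1 g] f(5) we by (fastforce simp: weight_add)
  qed
  moreover have "f * g = f0 * g0 + f0 * g1 + f1 * g"
    by (simp add: f(2) g(2) algebra_simps)
  ultimately have "e \<in> Poly_Mapping.keys (f * g)"
    using e by (simp add: in_keys_iff lookup_add)
  then have "ord_along C (f * g) \<le> enat (p + q)"
    using ord_along_le we by metis
  moreover have "enat (p + q) \<le> ord_along C (f * g)"
    unfolding le_ord_along_iff
  proof
    fix e assume "e \<in> Poly_Mapping.keys (f * g)"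
    then obtain a b where "e = a + b" "a \<in> Poly_Mapping.keys f" "b \<in> Poly_Mapping.keys g"
      using keys_mult[of f g] by blast
    moreover from this have "p \<le> weight C a" "q \<le> weight C b"
      using ord_along_le[of a f C] ord_along_le[of b g C] f(1) g(1) by simp_all
    ultimately show "p + q \<le> weight C e"
      by (simp add: weight_add)
  qed
  ultimately show ?thesis
    using f(1) g(1) by (simp add: order_antisym)
qed auto

lemma ord_along_prod:
  fixes f :: "'a \<Rightarrow> 'k::field mpoly"
  assumes "finite A"
  shows "ord_along C (\<Prod>i\<in>A. f i) = (\<Sum>i\<in>A. ord_along C (f i))"
  using assms by induction (auto simp: ord_along_mult)

text \<open>If $C$ is a minimal vertex cover, then this sum has order 0 along all other minimal vertex covers,
as none of them contains $C$.\<close>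

lemma ord_along_sum_X:
  assumes "finite C" "C \<noteq> {}" "finite D"
  shows "ord_along D (\<Sum>v\<in>C. X v :: 'k::comm_ring_1 mpoly) = (if C \<subseteq> D then 1 else 0)"
proof -
  let ?x = "\<lambda>v::nat. Poly_Mapping.single v (1::nat)"
  have inj: "inj_on ?x C"
    by (rule inj_onI) (metis keys_single one_neq_zero singleton_inject)
  have "(\<Sum>v\<in>C. X v :: 'k mpoly) = (\<Sum>e\<in>?x ` C. Poly_Mapping.single e 1)"
    using inj by (simp add: X_def sum.reindex)
  then have "Poly_Mapping.keys (\<Sum>v\<in>C. X v :: 'k mpoly) = ?x ` C"
    using assms(1) by (auto simp: in_keys_iff lookup_sum_single split: if_splits)
  then have ord: "ord_along D (\<Sum>v\<in>C. X v :: 'k mpoly) = (INF v\<in>C. if v \<in> D then 1 else 0)"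
    using assms(3) by (simp add: ord_along_def image_image weight_def lookup_single when_def
        enat_0_iff one_enat_def zero_enat_def if_distrib cong: if_cong)
  show ?thesis
  proof (cases "C \<subseteq> D")
    case True
    then have "(\<lambda>v. if v \<in> D then 1 else 0 :: enat) ` C = {1}"
      using assms(2) by auto
    then show ?thesis
      using True ord by simp
  next
    case False
    then obtain v where "v \<in> C" "v \<notin> D"
      by blast
    then have "(INF v\<in>C. if v \<in> D then 1 else 0 :: enat) \<le> 0"
      by (intro INF_lower2[of v]) auto
    then show ?thesis
      using False ord by simp
  qed
qed

section \<open>Ideals of the polynomial ring and their powers\<close>

lemma mpoly_ring_prod_closed:
  assumes "\<And>i. i \<in> A \<Longrightarrow> f i \<in> carrier (mpoly_ring n)"
  shows "prod f A \<in> carrier (mpoly_ring n)"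
proof -
  interpret cring "mpoly_ring n :: 'b mpoly ring"
    by (rule mpoly_ring_cring)
  show ?thesis
    using assms
    by (induction A rule: infinite_finite_induct) (use one_closed m_closed in auto)
qed

lemma mpoly_ring_finprod:
  assumes "finite A" "f \<in> A \<rightarrow> carrier (mpoly_ring n)"
  shows "finprod (mpoly_ring n) f A = prod f A"
proof -
  interpret cring "mpoly_ring n :: 'b mpoly ring"
    by (rule mpoly_ring_cring)
  show ?thesis
    using assms by (induction A) (auto simp: Pi_iff)
qed

lemma ideal_sum_mem:
  assumes J: "ideal J (mpoly_ring n)" and f: "\<And>i. i \<in> A \<Longrightarrow> f i \<in> J"
  shows "sum f A \<in> J"
proof -
  note sub = ideal.axioms(1)[OF J]
  show ?thesis
    using f
    by (induction A rule: infinite_finite_induct)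
       (use additive_subgroup.zero_closed[OF sub] additive_subgroup.a_closed[OF sub] in auto)
qed

text \<open>Coefficients are elements of the ring, so an ideal absorbs them.\<close>

lemma mem_ideal_if_monomials_mem:
  fixes f :: "'k::comm_ring_1 mpoly"
  assumes J: "ideal J (mpoly_ring n)"
    and mon: "\<And>e. e \<in> Poly_Mapping.keys f \<Longrightarrow> Poly_Mapping.single e 1 \<in> J"
  shows "f \<in> J"
proof -
  have "Poly_Mapping.single e (Poly_Mapping.lookup f e) \<in> J" if e: "e \<in> Poly_Mapping.keys f" for e
  proof -
    have "Poly_Mapping.single 0 c \<in> carrier (mpoly_ring n)" for c :: 'k
      by (simp add: mpoly_ring_carrier_iff)
    then have "Poly_Mapping.single 0 (Poly_Mapping.lookup f e) * Poly_Mapping.single e 1 \<in> J"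
      using ideal.I_l_closed[OF J mon[OF e]] by simp
    then show ?thesis
      by (simp add: mult_single)
  qed
  then show ?thesis
    using ideal_sum_mem[OF J] poly_mapping_sum_single[of f] by metis
qed

lemma ideal_ord_along_ge:
  "ideal {f \<in> carrier (mpoly_ring n). enat m \<le> ord_along C f} (mpoly_ring n :: 'k::field mpoly ring)"
proof -
  interpret cring "mpoly_ring n :: 'k mpoly ring"
    by (rule mpoly_ring_cring)
  let ?J = "{f \<in> carrier (mpoly_ring n :: 'k mpoly ring). enat m \<le> ord_along C f}"
  have mult: "r * f \<in> ?J" if "f \<in> ?J" "r \<in> carrier (mpoly_ring n)" for f r
    using that m_closed[of r f] by (auto simp: ord_along_mult add_increasing)
  have add: "f + g \<in> ?J" if "f \<in> ?J" "g \<in> ?J" for f g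
    using that a_closed[of f g] Poly_Mapping.keys_add[of f g] by (auto simp: le_ord_along_iff)
  have "inv\<^bsub>add_monoid (mpoly_ring n)\<^esub> f \<in> ?J" if "f \<in> ?J" for f
  proof -
    have "\<ominus>\<^bsub>mpoly_ring n\<^esub> f = (\<ominus>\<^bsub>mpoly_ring n\<^esub> 1) * f"
      using that l_minus[of 1 f] one_closed by simp
    also have "\<dots> \<in> ?J"
      using that a_inv_closed[of 1] one_closed by (intro mult) auto
    finally show ?thesis
      by (simp add: a_inv_def)
  qed
  moreover have "0 \<in> ?J"
    using zero_closed by simp
  ultimately have "subgroup ?J (add_monoid (mpoly_ring n))"
    using add by (intro subgroup.intro) auto
  then show ?thesis
    by (rule idealI[OF ring_axioms]) (use mult in \<open>auto simp: mult.commute\<close>)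
qed

lemma ideals_set_simps [simp]:
  "\<one>\<^bsub>ideals_set R\<^esub> = carrier R"
  "I \<otimes>\<^bsub>ideals_set R\<^esub> J = ideal_prod R I J"
  by (simp_all add: ideals_set_def)

lemma (in cring) ideal_power_ideal:
  "ideal I R \<Longrightarrow> ideal (I [^]\<^bsub>ideals_set R\<^esub> (m::nat)) R"
  by (induction m) (auto simp: oneideal ideal_prod_is_ideal)

lemma (in cring) ideal_power_one:
  assumes "ideal I R"
  shows "I [^]\<^bsub>ideals_set R\<^esub> (1::nat) = I"
  using ideal_prod_commute[OF oneideal assms] ideal_prod_one[OF assms]
  by simp

lemma (in cring) ideal_power_mult_mem:
  assumes "ideal I R" "p \<in> I [^]\<^bsub>ideals_set R\<^esub> (a::nat)" "q \<in> I [^]\<^bsub>ideals_set R\<^esub> (b::nat)"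
  shows "p \<otimes> q \<in> I [^]\<^bsub>ideals_set R\<^esub> (a + b)"
proof -
  interpret M: comm_monoid "ideals_set R"
    by (rule ideals_set_is_comm_monoid)
  have "I \<in> carrier (ideals_set R)"
    using assms(1) by (simp add: ideals_set_def)
  then have "I [^]\<^bsub>ideals_set R\<^esub> (a + b) =
      ideal_prod R (I [^]\<^bsub>ideals_set R\<^esub> a) (I [^]\<^bsub>ideals_set R\<^esub> b)"
    using M.nat_pow_mult[of I a b] by (simp add: ideals_set_def)
  then show ?thesis
    using assms by (simp add: ideal_prod.prod)
qed

lemma (in cring) ideal_power_antimono:
  assumes "ideal I R" "a \<le> b"
  shows "I [^]\<^bsub>ideals_set R\<^esub> (b::nat) \<subseteq> I [^]\<^bsub>ideals_set R\<^esub> (a::nat)"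
  using assms(2)
proof (induction b rule: dec_induct)
  case (step b)
  then show ?case
    using ideal_prod_inter[OF ideal_power_ideal[OF assms(1)] assms(1)]
    by fastforce
qed simp

lemma ideal_power_prod_mem:
  fixes p :: "'a \<Rightarrow> 'k::comm_ring_1 mpoly"
  assumes I: "ideal I (mpoly_ring n)" and "finite A" "\<And>i. i \<in> A \<Longrightarrow> p i \<in> I"
  shows "(\<Prod>i\<in>A. p i ^ y i) \<in> I [^]\<^bsub>ideals_set (mpoly_ring n)\<^esub> (\<Sum>i\<in>A. y i)"
proof -
  interpret cring "mpoly_ring n :: 'k mpoly ring"
    by (rule mpoly_ring_cring)
  have one: "1 \<in> I [^]\<^bsub>ideals_set (mpoly_ring n)\<^esub> (0::nat)"
    using one_closed by simp
  have "x ^ k \<in> I [^]\<^bsub>ideals_set (mpoly_ring n)\<^esub> k" if x: "x \<in> I" for x and k :: nat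
  proof (induction k)
    case (Suc k)
    then show ?case
      using x ideal_prod.prod[OF Suc x, of "mpoly_ring n"] by (simp add: mult.commute)
  qed (use one in simp)
  with assms(2,3) show ?thesis
    by (induction A) (use one in \<open>simp, use ideal_power_mult_mem[OF I] in simp\<close>)
qed

lemma ideal_power_ord_along:
  fixes I :: "'k::field mpoly set"
  assumes "\<And>f. f \<in> I \<Longrightarrow> enat c \<le> ord_along C f"
    and "f \<in> I [^]\<^bsub>ideals_set (mpoly_ring n)\<^esub> (m::nat)"
  shows "enat (m * c) \<le> ord_along C f"
  using assms(2)
proof (induction m arbitrary: f)
  case (Suc m)
  then have "f \<in> ideal_prod (mpoly_ring n) (I [^]\<^bsub>ideals_set (mpoly_ring n)\<^esub> m) I"
    by simp
  then show ?case
  proof induction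
    case (prod g h)
    then have "enat (m * c) + enat c \<le> ord_along C g + ord_along C h"
      using Suc.IH assms(1) by (intro add_mono) auto
    then show ?case
      by (simp add: ord_along_mult add.commute)
  next
    case (sum g h)
    then show ?case
      using Poly_Mapping.keys_add[of g h] by (auto simp: le_ord_along_iff)
  qed
qed (simp add: zero_enat_def[symmetric])

section \<open>The powers of the edge ideal of the cycle\<close>

lemma monomial_eq_prod_X:
  assumes "Poly_Mapping.keys e \<subseteq> {1..n}"
  shows "Poly_Mapping.single e 1 =
    (\<Prod>i\<in>{1..n}. X i ^ Poly_Mapping.lookup e i :: 'k::comm_ring_1 mpoly)"
proof -
  have pow: "X i ^ k = (Poly_Mapping.single (Poly_Mapping.single i k) 1 :: 'k mpoly)" for i k
    by (induction k) (simp_all add: X_def mult_single single_add[symmetric])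
  have "(\<Prod>i\<in>A. Poly_Mapping.single (d i) 1 :: 'k mpoly) = Poly_Mapping.single (\<Sum>i\<in>A. d i) 1"
    for A :: "nat set" and d
    by (induction A rule: infinite_finite_induct) (simp_all add: mult_single)
  moreover have "(\<Sum>i\<in>{1..n}. Poly_Mapping.single i (Poly_Mapping.lookup e i)) = e"
    using assms by (intro poly_mapping_eqI) (auto simp: lookup_sum_single in_keys_iff)
  ultimately show ?thesis
    by (simp add: pow)
qed

lemma ideal_cycle_edge_ideal:
  assumes "n \<ge> 1"
  shows "ideal (cycle_edge_ideal n) (mpoly_ring n :: 'k::comm_ring_1 mpoly ring)"
    and "X n * X 1 \<in> (cycle_edge_ideal n :: 'k mpoly set)"
    and "1 \<le> i \<Longrightarrow> i < n \<Longrightarrow> X i * X (i + 1) \<in> (cycle_edge_ideal n :: 'k mpoly set)"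
proof -
  interpret cring "mpoly_ring n :: 'k mpoly ring"
    by (rule mpoly_ring_cring)
  let ?G = "insert (X n * X 1) {X i * X (i + 1) | i. 1 \<le> i \<and> i < n} :: 'k mpoly set"
  have X: "X i * X j \<in> carrier (mpoly_ring n :: 'k mpoly ring)" if "i \<in> {1..n}" "j \<in> {1..n}" for i j
    using m_closed[OF X_in_mpoly_ring[OF that(1)] X_in_mpoly_ring[OF that(2)]] by simp
  have G: "?G \<subseteq> carrier (mpoly_ring n)"
    using assms by (auto intro!: X)
  show "ideal (cycle_edge_ideal n) (mpoly_ring n :: 'k mpoly ring)"
    unfolding cycle_edge_ideal_def using G by (rule genideal_ideal)
  show "X n * X 1 \<in> (cycle_edge_ideal n :: 'k mpoly set)"
    and "1 \<le> i \<Longrightarrow> i < n \<Longrightarrow> X i * X (i + 1) \<in> (cycle_edge_ideal n :: 'k mpoly set)"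
    unfolding cycle_edge_ideal_def using genideal_self[OF G] by auto
qed

lemma ord_along_X: "finite D \<Longrightarrow> ord_along D (X v :: 'k::comm_ring_1 mpoly) = (if v \<in> D then 1 else 0)"
  using ord_along_sum_X[of "{v}" D] by simp

lemma cycle_edge_ideal_ord_along:
  fixes f :: "'k::field mpoly"
  assumes "n \<ge> 1" "f \<in> cycle_edge_ideal n"
    and "enat c \<le> ord_along C (X n * X 1 :: 'k mpoly)"
    and "\<And>i. 1 \<le> i \<Longrightarrow> i < n \<Longrightarrow> enat c \<le> ord_along C (X i * X (i + 1) :: 'k mpoly)"
  shows "enat c \<le> ord_along C f"
proof -
  interpret cring "mpoly_ring n :: 'k mpoly ring"
    by (rule mpoly_ring_cring)
  have "cycle_edge_ideal n \<subseteq> {f \<in> carrier (mpoly_ring n :: 'k mpoly ring). enat c \<le> ord_along C f}"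
    unfolding cycle_edge_ideal_def
  proof (rule genideal_minimal[OF ideal_ord_along_ge])
    show "insert (X n * X 1) {X i * X (i + 1) |i. 1 \<le> i \<and> i < n}
        \<subseteq> {f \<in> carrier (mpoly_ring n :: 'k mpoly ring). enat c \<le> ord_along C f}"
      using assms ideal.Icarr[OF ideal_cycle_edge_ideal(1)[OF assms(1)]]
        ideal_cycle_edge_ideal(2,3)[OF assms(1)]
      by (auto simp del: One_nat_def)
  qed
  then show ?thesis
    using assms(2) by blast
qed

text \<open>The product of the edge generators, the $i$-th one taken $y_i$ times, divides the monomial: it has
exponent $y_{i-1} + y_i$ at the $i$-th variable.\<close>

lemma packed_monomial_mem_power:
  assumes n: "n \<ge> 1" and y: "y 0 = y n" "\<forall>i\<in>{1..n}. y (i - 1) + y i \<le> a i" "m \<le> sum y {1..n}"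
  shows "(\<Prod>i\<in>{1..n}. X i ^ a i :: 'k::comm_ring_1 mpoly)
    \<in> cycle_edge_ideal n [^]\<^bsub>ideals_set (mpoly_ring n)\<^esub> m"
proof -
  interpret cring "mpoly_ring n :: 'k mpoly ring"
    by (rule mpoly_ring_cring)
  let ?I = "cycle_edge_ideal n :: 'k mpoly set"
  note I = ideal_cycle_edge_ideal[OF n, where 'k = 'k]
  \<comment> \<open>The generator for the edge that leaves vertex \<open>i\<close>.\<close>
  define E where "E i = (if i = n then X n * X 1 else X i * X (i + 1) :: 'k mpoly)" for i
  obtain k where k: "n = Suc k"
    using n by (cases n) auto
  have "(\<Prod>i\<in>{1..n}. X i ^ y (i - 1) :: 'k mpoly) = (\<Prod>i\<in>{0..k}. X (Suc i) ^ y i)"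
    unfolding k using prod.shift_bounds_cl_Suc_ivl[of "\<lambda>i. X i ^ y (i - 1)" 0 k] by simp
  also have "\<dots> = X 1 ^ y n * (\<Prod>i\<in>{1..k}. X (i + 1) ^ y i)"
    using y(1) by (simp add: prod.atLeast_Suc_atMost)
  finally have "(\<Prod>i\<in>{1..n}. X i ^ y i) * (\<Prod>i\<in>{1..n}. X i ^ y (i - 1)) =
      (\<Prod>i\<in>{1..k}. (X i * X (i + 1)) ^ y i) * (X n * X 1 :: 'k mpoly) ^ y n"
    by (simp add: k power_mult_distrib prod.distrib mult_ac)
  also have "\<dots> = (\<Prod>i\<in>{1..n}. E i ^ y i)"
    by (simp add: k E_def)
  finally have edges: "(\<Prod>i\<in>{1..n}. X i ^ y i) * (\<Prod>i\<in>{1..n}. X i ^ y (i - 1)) =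
      (\<Prod>i\<in>{1..n}. E i ^ y i)" .
  have "(\<Prod>i\<in>{1..n}. X i ^ a i :: 'k mpoly)
      = (\<Prod>i\<in>{1..n}. X i ^ (a i - (y (i - 1) + y i)) * (X i ^ y i * X i ^ y (i - 1)))"
    using y(2) by (intro prod.cong) (auto simp: power_add[symmetric] simp del: One_nat_def)
  also have "\<dots> = (\<Prod>i\<in>{1..n}. X i ^ (a i - (y (i - 1) + y i))) * (\<Prod>i\<in>{1..n}. E i ^ y i)"
    by (simp add: prod.distrib edges[symmetric] del: One_nat_def)
  also have "\<dots> \<in> ?I [^]\<^bsub>ideals_set (mpoly_ring n)\<^esub> sum y {1..n}"
  proof -
    have "X i ^ k \<in> carrier (mpoly_ring n :: 'k mpoly ring)" if "i \<in> {1..n}" for i k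
      using mpoly_ring_prod_closed[of "{1..k}" "\<lambda>_. X i" n] X_in_mpoly_ring[OF that] by simp
    then have "(\<Prod>i\<in>{1..n}. X i ^ (a i - (y (i - 1) + y i))) \<in> carrier (mpoly_ring n :: 'k mpoly ring)"
      by (intro mpoly_ring_prod_closed)
    moreover have "(\<Prod>i\<in>{1..n}. E i ^ y i) \<in> ?I [^]\<^bsub>ideals_set (mpoly_ring n)\<^esub> sum y {1..n}"
      by (rule ideal_power_prod_mem[OF I(1)]) (use I in \<open>auto simp: E_def\<close>)
    ultimately show ?thesis
      using ideal.I_l_closed[OF ideal_power_ideal[OF I(1)]] by simp
  qed
  also have "\<dots> \<subseteq> ?I [^]\<^bsub>ideals_set (mpoly_ring n)\<^esub> m"
    using y(3) by (rule ideal_power_antimono[OF I(1)])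
  finally show ?thesis .
qed

text \<open>Necessity holds because each generator has order at least 1 along a cover and order 2 along all
the variables. Sufficiency is tested on monomials, for which the orders are the weights in
\<open>cycle_packing\<close>, and a packing by $m$ edges writes the monomial as a multiple of a product of
$m$ generators.\<close>

lemma mem_cycle_edge_ideal_power_iff:
  fixes f :: "'k::field mpoly"
  assumes n: "n \<ge> 2"
  shows "f \<in> cycle_edge_ideal n [^]\<^bsub>ideals_set (mpoly_ring n)\<^esub> m \<longleftrightarrow>
    f \<in> carrier (mpoly_ring n) \<and> (\<forall>C\<in>minimal_covers n. enat m \<le> ord_along C f) \<and>
    enat (2 * m) \<le> ord_along {1..n} f"
    (is "f \<in> ?P \<longleftrightarrow> ?rhs")
proof -
  interpret cring "mpoly_ring n :: 'k mpoly ring"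
    by (rule mpoly_ring_cring)
  have n1: "n \<ge> 1" using n by simp
  note I = ideal_cycle_edge_ideal[OF n1, where 'k = 'k]
  note P = ideal_power_ideal[OF I(1), of m]
  show ?thesis
  proof
    assume f: "f \<in> ?P"
    have "enat (m * 1) \<le> ord_along C f" if C: "C \<in> minimal_covers n" for C
    proof (rule ideal_power_ord_along[OF _ f])
      fix g :: "'k mpoly" assume g: "g \<in> cycle_edge_ideal n"
      have one: "enat (Suc 0) = 1" by (simp add: one_enat_def)
      have "cycle_cover n C" using C by (simp add: minimal_covers_def)
      then show "enat 1 \<le> ord_along C g"
        by (intro cycle_edge_ideal_ord_along[OF n1 g])
           (auto simp: cycle_cover_def path_cover_def ord_along_mult minimal_cover_finite[OF C]
             ord_along_X one)
    qed
    moreover have "enat (m * 2) \<le> ord_along {1..n} f"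
    proof (rule ideal_power_ord_along[OF _ f])
      fix g :: "'k mpoly" assume g: "g \<in> cycle_edge_ideal n"
      have "(1::enat) + 1 = enat 2"
        by (simp add: one_enat_def)
      then show "enat 2 \<le> ord_along {1..n} g"
        using n1 by (intro cycle_edge_ideal_ord_along[OF n1 g]) (auto simp: ord_along_mult ord_along_X)
    qed
    ultimately show ?rhs
      using ideal.Icarr[OF P f] by (simp add: mult.commute)
  next
    assume rhs: ?rhs
    show "f \<in> ?P"
    proof (rule mem_ideal_if_monomials_mem[OF P])
      fix e assume e: "e \<in> Poly_Mapping.keys f"
      have "m \<le> sum (Poly_Mapping.lookup e) C" if C: "cycle_cover n C" for C
      proof -
        obtain D where D: "D \<in> minimal_covers n" "D \<subseteq> C"
          using C by (rule cover_contains_minimal_cover)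
        then have "m \<le> weight D e"
          using rhs e by (simp add: le_ord_along_iff)
        also have "\<dots> \<le> weight C e"
          using D(2) finite_subset[OF cycle_cover_subset[OF C]] by (intro weight_mono) auto
        finally show ?thesis by (simp add: weight_def)
      qed
      moreover have "2 * m \<le> sum (Poly_Mapping.lookup e) {1..n}"
        using rhs e by (simp add: le_ord_along_iff weight_def)
      ultimately obtain y where "y 0 = y n" "m \<le> sum y {1..n}"
          "\<forall>i\<in>{1..n}. y (i - 1) + y i \<le> Poly_Mapping.lookup e i"
        using cycle_packing[OF n] by blast
      then have "(\<Prod>i\<in>{1..n}. X i ^ Poly_Mapping.lookup e i) \<in> ?P"
        by (intro packed_monomial_mem_power[OF n1])
      moreover have "Poly_Mapping.keys e \<subseteq> {1..n}"
        using rhs e by (simp add: mpoly_ring_carrier_iff)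
      ultimately show "Poly_Mapping.single e 1 \<in> ?P"
        by (simp only: monomial_eq_prod_X)
    qed
  qed
qed

section \<open>Absorption by the powers of the edge ideal\<close>

text \<open>Elements of nonzero value contribute at least 1 each, so $m$ of them reach the sum $m$. The given
set $B$ of such elements is extended only while it has fewer than $m$ members.\<close>

lemma small_heavy_superset:
  fixes v :: "'a \<Rightarrow> enat"
  assumes "finite A" "enat m \<le> sum v A" "B \<subseteq> A" "\<And>i. i \<in> B \<Longrightarrow> v i \<noteq> 0"
  obtains S where "B \<subseteq> S" "S \<subseteq> A" "\<And>i. i \<in> S \<Longrightarrow> v i \<noteq> 0"
    "enat m \<le> sum v S" "card S \<le> max (card B) m"
proof -
  define T where "T = {i \<in> A. v i \<noteq> 0}"
  have T: "finite T" "B \<subseteq> T" "T \<subseteq> A"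
    using assms by (auto simp: T_def)
  have sumT: "sum v T = sum v A"
    unfolding T_def using assms(1) by (intro sum.mono_neutral_left) auto
  show thesis
  proof (cases "card T \<le> max (card B) m")
    case True
    show thesis
      by (rule that[of T]) (use T sumT assms True in \<open>auto simp: T_def\<close>)
  next
    case False
    then obtain S where S: "B \<subseteq> S" "S \<subseteq> T" "card S = max (card B) m"
      using exists_subset_between[of B "max (card B) m" T] T by (metis max.cobounded1 nle_le)
    have pos: "v i \<noteq> 0" if "i \<in> S" for i
      using that S(2) by (auto simp: T_def)
    have "enat m \<le> of_nat (card S)"
      using S(3) by (simp add: of_nat_eq_enat)
    also have "\<dots> = sum (\<lambda>_. 1) S"
      by simp
    also have "\<dots> \<le> sum v S"
      using pos by (intro sum_mono) (simp add: ileI1 one_eSuc zero_less_iff_neq_zero)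
    finally show thesis
      using that S T pos by auto
  qed
qed

text \<open>Of the factors of a product in the ideal, at most $m$ are kept for each minimal cover, and then
further ones until the order along all the variables is at least $2m$. Since there are at least
two minimal covers, this keeps at most \<open>m * card (minimal_covers n)\<close> factors, so that one can be dropped.\<close>

lemma absorbing_ideal_cycle_power:
  assumes n: "n \<ge> 2"
  shows "absorbing_ideal (m * card (minimal_covers n))
    (cycle_edge_ideal n [^]\<^bsub>ideals_set (mpoly_ring n)\<^esub> m) (mpoly_ring n :: 'k::field mpoly ring)"
    (is "absorbing_ideal ?N ?P ?R")
proof -
  interpret cring ?R
    by (rule mpoly_ring_cring)
  have n1: "n \<ge> 1" using n by simp
  have "\<exists>j\<in>{1..?N + 1}. finprod ?R f ({1..?N + 1} - {j}) \<in> ?P"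
    if f: "f \<in> {1..?N + 1} \<rightarrow> carrier ?R" and fP: "finprod ?R f {1..?N + 1} \<in> ?P" for f
  proof -
    let ?A = "{1..?N + 1}"
    have "prod f ?A \<in> ?P"
      using fP f by (simp add: mpoly_ring_finprod)
    then have ord: "enat m \<le> (\<Sum>i\<in>?A. ord_along C (f i))" if "C \<in> minimal_covers n" for C
      using \<open>prod f ?A \<in> ?P\<close> that
      by (simp add: mem_cycle_edge_ideal_power_iff[OF n] ord_along_prod ord_along_mult)
    have deg: "enat (2 * m) \<le> (\<Sum>i\<in>?A. ord_along {1..n} (f i))"
      using \<open>prod f ?A \<in> ?P\<close>
      by (simp add: mem_cycle_edge_ideal_power_iff[OF n] ord_along_prod ord_along_mult)
    have "\<exists>S. S \<subseteq> ?A \<and> (\<forall>i\<in>S. ord_along C (f i) \<noteq> 0)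
        \<and> enat m \<le> (\<Sum>i\<in>S. ord_along C (f i)) \<and> card S \<le> m"
      if C: "C \<in> minimal_covers n" for C
      by (rule small_heavy_superset[of ?A m "\<lambda>i. ord_along C (f i)" "{}"]) (use ord[OF C] in auto)
    then obtain S where S: "\<And>C. C \<in> minimal_covers n \<Longrightarrow> S C \<subseteq> ?A"
        "\<And>C i. C \<in> minimal_covers n \<Longrightarrow> i \<in> S C \<Longrightarrow> ord_along C (f i) \<noteq> 0"
        "\<And>C. C \<in> minimal_covers n \<Longrightarrow> enat m \<le> (\<Sum>i\<in>S C. ord_along C (f i))"
        "\<And>C. C \<in> minimal_covers n \<Longrightarrow> card (S C) \<le> m"
      by metis
    define U where "U = (\<Union>C\<in>minimal_covers n. S C)"
    have "ord_along {1..n} (f i) \<noteq> 0" if i: "i \<in> U" for i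
    proof -
      obtain C where C: "C \<in> minimal_covers n" "i \<in> S C"
        using i by (auto simp: U_def)
      have "ord_along C (f i) \<le> ord_along {1..n} (f i)"
        using minimal_cover_subset[OF C(1)] by (intro ord_along_mono) auto
      then show ?thesis
        using S(2)[OF C] by auto
    qed
    moreover have "U \<subseteq> ?A"
      using S(1) by (auto simp: U_def)
    ultimately obtain T where T: "U \<subseteq> T" "T \<subseteq> ?A" "enat (2 * m) \<le> (\<Sum>i\<in>T. ord_along {1..n} (f i))"
        "card T \<le> max (card U) (2 * m)"
      using small_heavy_superset[of ?A "2 * m" "\<lambda>i. ord_along {1..n} (f i)" U] deg
      by (metis finite_atLeastAtMost)
    have "card U \<le> (\<Sum>C\<in>minimal_covers n. card (S C))"
      unfolding U_def using finite_minimal_covers by (rule card_UN_le)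
    also have "\<dots> \<le> card (minimal_covers n) * m"
      using sum_bounded_above[of "minimal_covers n" "\<lambda>C. card (S C)" m] S(4) by simp
    finally have "card U \<le> ?N"
      by (simp add: mult.commute)
    moreover have "2 * m \<le> ?N"
      using two_le_card_minimal_covers[OF n] by (simp add: mult.commute)
    ultimately have "max (card U) (2 * m) \<le> ?N"
      by (rule max.boundedI)
    with T(4) have "card T \<le> ?N"
      by (rule order_trans)
    then have "card T < card ?A"
      by simp
    then obtain j where j: "j \<in> ?A" "j \<notin> T"
      using T(2) by (metis psubsetI psubset_imp_ex_mem less_irrefl DiffE)
    have T_sub: "T \<subseteq> ?A - {j}"
      using T(2) j by blast
    have "enat m \<le> (\<Sum>i\<in>?A - {j}. ord_along C (f i))" if C: "C \<in> minimal_covers n" for C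
      using S(3)[OF C]
    proof (rule order_trans)
      have "S C \<subseteq> ?A - {j}"
        using T(1) T_sub C by (auto simp: U_def)
      then show "(\<Sum>i\<in>S C. ord_along C (f i)) \<le> (\<Sum>i\<in>?A - {j}. ord_along C (f i))"
        by (intro sum_mono2) auto
    qed
    moreover have "enat (2 * m) \<le> (\<Sum>i\<in>?A - {j}. ord_along {1..n} (f i))"
      using T(3)
    proof (rule order_trans)
      show "(\<Sum>i\<in>T. ord_along {1..n} (f i)) \<le> (\<Sum>i\<in>?A - {j}. ord_along {1..n} (f i))"
        using T_sub by (intro sum_mono2) auto
    qed
    moreover have "prod f (?A - {j}) \<in> carrier ?R"
      using f by (intro mpoly_ring_prod_closed) auto
    ultimately have "prod f (?A - {j}) \<in> ?P"
      by (simp add: mem_cycle_edge_ideal_power_iff[OF n] ord_along_prod)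
    moreover have "finprod ?R f (?A - {j}) = prod f (?A - {j})"
      using f by (intro mpoly_ring_finprod) auto
    ultimately have "finprod ?R f (?A - {j}) \<in> ?P"
      by simp
    then show ?thesis
      using j(1) by blast
  qed
  then show ?thesis
    unfolding absorbing_ideal_def
    using ideal_power_ideal[OF ideal_cycle_edge_ideal(1)[OF n1]] by blast
qed

text \<open>For a minimal cover $C$ let $g_C$ be the sum of its variables. The product in which each $g_C$
occurs $m$ times has order exactly $m$ along each minimal cover. If $N$ were smaller than the
number of these factors, they could be grouped into $N + 1$ factors; dropping any group loses a
factor $g_D$, and the order along $D$ falls below $m$.\<close>

lemma le_if_absorbing_ideal_cycle_power:
  assumes n: "n \<ge> 2"
    and abs: "absorbing_ideal N
      (cycle_edge_ideal n [^]\<^bsub>ideals_set (mpoly_ring n)\<^esub> m) (mpoly_ring n :: 'k::field mpoly ring)"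
    (is "absorbing_ideal N ?P ?R")
  shows "m * card (minimal_covers n) \<le> N"
proof (rule ccontr)
  let ?M = "m * card (minimal_covers n)"
  assume "\<not> ?M \<le> N"
  then have NM: "N < ?M" by simp
  interpret cring ?R
    by (rule mpoly_ring_cring)
  define g :: "nat set \<Rightarrow> 'k mpoly" where "g C = (\<Sum>v\<in>C. X v)" for C
  have g_closed: "g C \<in> carrier ?R" if "C \<subseteq> {1..n}" for C
  proof -
    have "g C \<in> carrier ?R" if "finite C" "C \<subseteq> {1..n}"
      using that
    proof (induction C)
      case (insert v C)
      then show ?case
        using a_closed[OF X_in_mpoly_ring[of v n], of "g C"] by (simp add: g_def)
    qed (use zero_closed in \<open>simp add: g_def\<close>)
    then show ?thesis
      using that finite_subset by blast
  qed
  have ord_g: "ord_along D (g C) = (if C = D then 1 else 0)"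
    if "C \<in> minimal_covers n" "D \<in> minimal_covers n" for C D
    unfolding g_def using that minimal_covers_antichain[OF that]
    by (subst ord_along_sum_X) (auto simp: minimal_cover_nonempty minimal_cover_finite)
  have deg_g: "ord_along {1..n} (g C) = 1" if C: "C \<in> minimal_covers n" for C
    unfolding g_def using minimal_cover_subset[OF C]
    by (subst ord_along_sum_X) (use C minimal_cover_nonempty minimal_cover_finite in auto)
  have "card {1..?M} = card (minimal_covers n \<times> {1..m})"
    by (simp add: card_cartesian_product)
  then obtain h where h: "bij_betw h {1..?M} (minimal_covers n \<times> {1..m})"
    using finite_same_card_bij[of "{1..?M}" "minimal_covers n \<times> {1..m}"] finite_minimal_covers
    by auto
  define c where "c i = fst (h i)" for i
  have c: "c i \<in> minimal_covers n" if "i \<in> {1..?M}" for i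
    using bij_betwE[OF h] that by (auto simp: c_def mem_Times_iff)
  have ord_total: "(\<Sum>i\<in>{1..?M}. ord_along D (g (c i))) = enat m" if D: "D \<in> minimal_covers n" for D
  proof -
    have "(\<Sum>i\<in>{1..?M}. ord_along D (g (c i))) = (\<Sum>i\<in>{1..?M}. if fst (h i) = D then 1 else 0)"
      using c D by (intro sum.cong) (auto simp: ord_g c_def)
    also have "\<dots> = (\<Sum>x\<in>minimal_covers n \<times> {1..m}. if fst x = D then 1 else 0)"
      using h by (rule sum.reindex_bij_betw)
    also have "\<dots> = (\<Sum>C\<in>minimal_covers n. \<Sum>l\<in>{1..m}. if C = D then 1 else 0)"
      by (subst sum.cartesian_product) (simp add: case_prod_beta)
    also have "\<dots> = (\<Sum>C\<in>minimal_covers n. if C = D then of_nat m else 0)"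
      by (intro sum.cong) auto
    also have "\<dots> = enat m"
      using D finite_minimal_covers by (simp add: of_nat_eq_enat)
    finally show ?thesis .
  qed
  \<comment> \<open>The first \<open>N\<close> groups are single factors, and the last one collects the rest.\<close>
  define f where "f i = (if i \<le> N then g (c i) else (\<Prod>l\<in>{N + 1..?M}. g (c l)))" for i
  have f: "f \<in> {1..N + 1} \<rightarrow> carrier ?R"
  proof
    fix i assume "i \<in> {1..N + 1}"
    have "g (c l) \<in> carrier ?R" if "l \<in> {1..?M}" for l
      using c[OF that] by (intro g_closed minimal_cover_subset)
    then show "f i \<in> carrier ?R"
      using NM \<open>i \<in> _\<close> by (auto simp: f_def intro!: mpoly_ring_prod_closed)
  qed
  have "prod f {1..N + 1} = (\<Prod>i\<in>{1..N}. g (c i)) * (\<Prod>l\<in>{N + 1..?M}. g (c l))"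
    by (simp add: f_def)
  also have "\<dots> = (\<Prod>i\<in>{1..?M}. g (c i))"
  proof -
    have "{1..?M} = {1..N} \<union> {N + 1..?M}"
      using NM by auto
    then show ?thesis
      by (simp add: prod.union_disjoint)
  qed
  finally have prod_f: "prod f {1..N + 1} = (\<Prod>i\<in>{1..?M}. g (c i))" .
  have "enat (2 * m) \<le> enat ?M"
    using two_le_card_minimal_covers[OF n] by (simp add: mult.commute)
  also have "\<dots> = (\<Sum>i\<in>{1..?M}. ord_along {1..n} (g (c i)))"
  proof -
    have "(\<Sum>i\<in>{1..?M}. ord_along {1..n} (g (c i))) = (\<Sum>i\<in>{1..?M}. 1)"
      using c by (intro sum.cong) (simp_all add: deg_g del: One_nat_def)
    then show ?thesis
      by (simp add: of_nat_eq_enat)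
  qed
  finally have "prod f {1..N + 1} \<in> ?P"
    using ord_total prod_f mpoly_ring_prod_closed[of "{1..N + 1}" f n] f
    by (simp add: mem_cycle_edge_ideal_power_iff[OF n] ord_along_prod Pi_iff)
  then obtain j where j: "j \<in> {1..N + 1}" "finprod ?R f ({1..N + 1} - {j}) \<in> ?P"
    using abs f unfolding absorbing_ideal_def by (metis finite_atLeastAtMost mpoly_ring_finprod)
  have "finprod ?R f ({1..N + 1} - {j}) = prod f ({1..N + 1} - {j})"
    using f by (intro mpoly_ring_finprod) auto
  with j have mem: "prod f ({1..N + 1} - {j}) \<in> ?P"
    by simp
  have jM: "j \<in> {1..?M}"
    using j(1) NM by auto
  \<comment> \<open>The factor with number \<open>j\<close> belongs to group \<open>j\<close>, also for the last group.\<close>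
  let ?D = "c j"
  have "1 \<le> ord_along ?D (f j)"
  proof (cases "j \<le> N")
    case True
    then show ?thesis
      using c[OF jM] by (simp add: f_def ord_g)
  next
    case False
    then have "j \<in> {N + 1..?M}"
      using j(1) jM by auto
    then have "ord_along ?D (g (c j)) \<le> (\<Sum>l\<in>{N + 1..?M}. ord_along ?D (g (c l)))"
      by (intro member_le_sum) auto
    then show ?thesis
      using False c[OF jM] by (simp add: f_def ord_g ord_along_prod)
  qed
  moreover have "enat m \<le> ord_along ?D (prod f ({1..N + 1} - {j}))"
    using mem c[OF jM] by (simp add: mem_cycle_edge_ideal_power_iff[OF n])
  moreover have "ord_along ?D (f j) + ord_along ?D (prod f ({1..N + 1} - {j})) = enat m"
  proof -
    have "ord_along ?D (f j) + ord_along ?D (prod f ({1..N + 1} - {j})) =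
        ord_along ?D (prod f {1..N + 1})"
      using j(1) by (simp add: ord_along_mult[symmetric] prod.remove[symmetric])
    also have "\<dots> = enat m"
      using ord_total[OF c[OF jM]] prod_f by (simp add: ord_along_prod)
    finally show ?thesis .
  qed
  ultimately have "1 + enat m \<le> enat m"
    by (metis add_mono)
  then show False
    by (simp add: one_enat_def)
qed

lemma omega_cycle_power:
  assumes n: "n \<ge> 2" and m: "m \<ge> 1"
  shows "omega (mpoly_ring n :: 'k::field mpoly ring)
    (cycle_edge_ideal n [^]\<^bsub>ideals_set (mpoly_ring n)\<^esub> m) = enat (m * card (minimal_covers n))"
    (is "omega ?R ?P = enat ?N")
proof -
  interpret cring ?R
    by (rule mpoly_ring_cring)
  have "1 \<notin> ?P"
    using m by (simp add: mem_cycle_edge_ideal_power_iff[OF n] enat_0_iff zero_enat_def)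
  then have "?P \<noteq> carrier ?R"
    using one_closed by auto
  moreover have "Inf {enat N |N. 1 \<le> N \<and> absorbing_ideal N ?P ?R} = enat ?N"
  proof (rule order_antisym)
    have "1 \<le> ?N"
      using m two_le_card_minimal_covers[OF n] by (simp add: Suc_le_eq)
    then show "Inf {enat N |N. 1 \<le> N \<and> absorbing_ideal N ?P ?R} \<le> enat ?N"
      using absorbing_ideal_cycle_power[OF n] by (intro Inf_lower) blast
    show "enat ?N \<le> Inf {enat N |N. 1 \<le> N \<and> absorbing_ideal N ?P ?R}"
      by (rule Inf_greatest) (use le_if_absorbing_ideal_cycle_power[OF n] in auto)
  qed
  ultimately show ?thesis
    by (simp add: omega_def)
qed

theorem lemma18:
  fixes n :: nat
  assumes "n \<ge> 3"
  shows "omega_linear (mpoly_ring n) (cycle_edge_ideal n :: 'k::field mpoly set)"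
proof -
  interpret cring "mpoly_ring n :: 'k mpoly ring"
    by (rule mpoly_ring_cring)
  let ?I = "cycle_edge_ideal n :: 'k mpoly set"
  have n: "n \<ge> 2" "n \<ge> 1" using assms by simp_all
  have "?I [^]\<^bsub>ideals_set (mpoly_ring n)\<^esub> (1::nat) = ?I"
    using ideal_cycle_edge_ideal(1)[OF n(2)] by (rule ideal_power_one)
  then have "omega (mpoly_ring n) ?I = enat (card (minimal_covers n))"
    using omega_cycle_power[OF n(1), of 1, where 'k = 'k] by simp
  then show ?thesis
    unfolding omega_linear_def using omega_cycle_power[OF n(1), where 'k = 'k] by simp
qed

end
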